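(* Let $(M^d,g)$ be compact without boundary and suppose the Laplace--Beltrami counting function satisfies Weyl's law $N_\Delta(\Lambda)\sim\gamma_d\Lambda^{d/2}$ as $\Lambda\to\infty$, with $\gamma_d>0$. Fix $\epsilon>0$, encode $C=\pi-\epsilon\lambda$, and set $$N_{\mu_C}(C):=\#\{n:C_n\ge C\}\quad(C<\pi),\qquad\rho_{\mathrm{bulk}}(C):=-\frac{d}{dC}N_{\mu_C}(C)\ (\ge0)$$ in the Stieltjes/distributional sense (or after a standard smoothing). Then, as $C\to-\infty$ (equivalently, $(\pi-C)/\epsilon\to\infty$), $$N_{\mu_C}(C)\sim\gamma_d\,\epsilon^{-d/2}(\pi-C)^{d/2}$$ and $$\rho_{\mathrm{bulk}}(C)\sim\frac d2\,\gamma_d\,\epsilon^{-d/2}(\pi-C)^{\frac{d-2}{2}}.$$ Conversely, if for some $A>0$ and $\alpha>0$, $N_{\mu_C}(C)\sim A(\pi-C)^\alpha$ as $C\to-\infty$, and $N_{\mu_C}$ is ultimately monotone, then necessarily $$d=2\alpha,\qquad\gamma_d=A\,\epsilon^{d/2}.$$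
   Context: $(M^d,g)$ is a smooth connected compact Riemannian manifold; $0=\lambda_0\le\lambda_1\le\cdots\to\infty$ are the eigenvalues of $-\Delta_g$ counted with multiplicity, $N_\Delta(\Lambda)=\#\{n:\lambda_n\le\Lambda\}$, and $C_n=\pi-\epsilon\lambda_n$. *)

theory Defs
  imports
    "HOL-Analysis.Analysis"
    "HOL-Library.Landau_Symbols"
    "HOL-Library.Function_Algebras"
begin

section \<open>Smooth maps and test functions\<close>

text \<open>Meant for open \<open>S\<close>: all iterated directional derivatives up to order \<open>k\<close> exist and are
  continuous on \<open>S\<close>.\<close>

primrec Ck_on :: "nat \<Rightarrow> 'a::real_normed_vector set \<Rightarrow> ('a \<Rightarrow> 'b::real_normed_vector) \<Rightarrow> bool" where
  "Ck_on 0 S f \<longleftrightarrow> continuous_on S f"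
| "Ck_on (Suc k) S f \<longleftrightarrow>
     (\<forall>x\<in>S. f differentiable (at x)) \<and> (\<forall>v. Ck_on k S (\<lambda>x. frechet_derivative f (at x) v))"

definition smooth_on :: "'a::real_normed_vector set \<Rightarrow> ('a \<Rightarrow> 'b::real_normed_vector) \<Rightarrow> bool" where
  "smooth_on S f \<longleftrightarrow> (\<forall>k. Ck_on k S f)"

definition test_function :: "real set \<Rightarrow> (real \<Rightarrow> real) \<Rightarrow> bool" where
  "test_function S \<phi> \<longleftrightarrow>
     smooth_on UNIV \<phi> \<and> compact (closure {x. \<phi> x \<noteq> 0}) \<and> closure {x. \<phi> x \<noteq> 0} \<subseteq> S"

section \<open>Riemannian manifolds without boundary\<close>

text \<open>The dimension is \<open>CARD('d)\<close>. Charts map onto open subsets of the full space, so there is no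
  boundary. The atlas need not be maximal.\<close>

type_synonym ('a, 'd) chart = "'a set \<times> ('a \<Rightarrow> real ^ 'd)"

definition transition :: "('a, 'd::finite) chart \<Rightarrow> ('a, 'd) chart \<Rightarrow> real ^ 'd \<Rightarrow> real ^ 'd" where
  "transition c c' = snd c' \<circ> inv_into (fst c) (snd c)"

definition smooth_manifold :: "'a topology \<Rightarrow> ('a, 'd::finite) chart set \<Rightarrow> bool" where
  "smooth_manifold X \<A> \<longleftrightarrow>
     Hausdorff_space X \<and> second_countable X \<and>
     (\<Union>c\<in>\<A>. fst c) = topspace X \<and>
     (\<forall>c\<in>\<A>. openin X (fst c) \<and> open (snd c ` fst c) \<and>
        homeomorphic_map (subtopology X (fst c)) (top_of_set (snd c ` fst c)) (snd c)) \<and>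
     (\<forall>c\<in>\<A>. \<forall>c'\<in>\<A>. smooth_on (snd c ` (fst c \<inter> fst c')) (transition c c'))"

text \<open>A metric is given by its coefficient matrices \<open>g\<^sub>i\<^sub>j\<close> in each chart, as functions of the
  coordinates, subject to the transformation law of a covariant 2-tensor.\<close>

definition riemannian_metric ::
  "('a, 'd::finite) chart set \<Rightarrow> (('a, 'd) chart \<Rightarrow> real ^ 'd \<Rightarrow> real ^ 'd ^ 'd) \<Rightarrow> bool" where
  "riemannian_metric \<A> g \<longleftrightarrow>
     (\<forall>c\<in>\<A>. smooth_on (snd c ` fst c) (g c) \<and>
        (\<forall>x\<in>snd c ` fst c. transpose (g c x) = g c x \<and> (\<forall>v. v \<noteq> 0 \<longrightarrow> v \<bullet> (g c x *v v) > 0))) \<and>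
     (\<forall>c\<in>\<A>. \<forall>c'\<in>\<A>. \<forall>x\<in>snd c ` (fst c \<inter> fst c').
        let J = jacobian (transition c c') (at x)
        in g c x = transpose J ** g c' (transition c c' x) ** J)"

section \<open>The Laplace--Beltrami operator and its spectrum\<close>

definition partial :: "'d::finite \<Rightarrow> (real ^ 'd \<Rightarrow> real) \<Rightarrow> real ^ 'd \<Rightarrow> real" where
  "partial i u x = frechet_derivative u (at x) (axis i 1)"

definition laplace_coord ::
  "(real ^ 'd \<Rightarrow> real ^ 'd ^ 'd) \<Rightarrow> (real ^ 'd::finite \<Rightarrow> real) \<Rightarrow> real ^ 'd \<Rightarrow> real" where
  "laplace_coord G u x =
     (\<Sum>i\<in>UNIV. \<Sum>j\<in>UNIV.
        partial i (\<lambda>y. sqrt (det (G y)) * matrix_inv (G y) $ i $ j * partial j u y) x)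
     / sqrt (det (G x))"

definition laplace_beltrami ::
  "(('a, 'd::finite) chart \<Rightarrow> real ^ 'd \<Rightarrow> real ^ 'd ^ 'd) \<Rightarrow> ('a, 'd) chart \<Rightarrow> ('a \<Rightarrow> real) \<Rightarrow> 'a \<Rightarrow> real"
  where
  "laplace_beltrami g c f p = laplace_coord (g c) (f \<circ> inv_into (fst c) (snd c)) (snd c p)"

definition smooth_function :: "('a, 'd::finite) chart set \<Rightarrow> ('a \<Rightarrow> real) \<Rightarrow> bool" where
  "smooth_function \<A> f \<longleftrightarrow> (\<forall>c\<in>\<A>. smooth_on (snd c ` fst c) (f \<circ> inv_into (fst c) (snd c)))"

text \<open>Real smooth solutions of \<open>-\<Delta>f = \<mu>f\<close>. Functions on the manifold are represented by functions on
  the ambient type vanishing off \<open>topspace X\<close>, so that the vector space has the right dimension.\<close>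

definition eigenspace ::
  "'a topology \<Rightarrow> ('a, 'd::finite) chart set \<Rightarrow> (('a, 'd) chart \<Rightarrow> real ^ 'd \<Rightarrow> real ^ 'd ^ 'd) \<Rightarrow>
   real \<Rightarrow> ('a \<Rightarrow> real) set" where
  "eigenspace X \<A> g \<mu> =
     {f. smooth_function \<A> f \<and> (\<forall>p. p \<notin> topspace X \<longrightarrow> f p = 0) \<and>
         (\<forall>c\<in>\<A>. \<forall>p\<in>fst c. - laplace_beltrami g c f p = \<mu> * f p)}"

interpretation real_fun: vector_space "\<lambda>(r::real) (f::'a \<Rightarrow> real) p. r * f p"
  by unfold_locales (auto simp: fun_eq_iff algebra_simps)

text \<open>\<open>lam\<close> lists the eigenvalues in nondecreasing order, each repeated according to its
  multiplicity. On a compact manifold all eigenspaces are finite-dimensional, so the convention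
  that \<open>real_fun.dim\<close> is \<open>0\<close> on infinite-dimensional spaces plays no role.\<close>

definition laplace_spectrum ::
  "'a topology \<Rightarrow> ('a, 'd::finite) chart set \<Rightarrow> (('a, 'd) chart \<Rightarrow> real ^ 'd \<Rightarrow> real ^ 'd ^ 'd) \<Rightarrow>
   (nat \<Rightarrow> real) \<Rightarrow> bool" where
  "laplace_spectrum X \<A> g lam \<longleftrightarrow>
     lam 0 = 0 \<and> incseq lam \<and> filterlim lam at_top sequentially \<and>
     (\<forall>\<mu>. card {n. lam n = \<mu>} = real_fun.dim (eigenspace X \<A> g \<mu>))"

section \<open>Counting functions\<close>

definition N_Delta :: "(nat \<Rightarrow> real) \<Rightarrow> real \<Rightarrow> real" where
  "N_Delta lam \<Lambda> = real (card {n. lam n \<le> \<Lambda>})"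

definition encode :: "real \<Rightarrow> real \<Rightarrow> real" where
  "encode \<epsilon> l = pi - \<epsilon> * l"

definition N_mu :: "real \<Rightarrow> (nat \<Rightarrow> real) \<Rightarrow> real \<Rightarrow> real" where
  "N_mu \<epsilon> lam C = real (card {n. encode \<epsilon> (lam n) \<ge> C})"

definition ultimately_monotone :: "(real \<Rightarrow> real) \<Rightarrow> bool" where
  "ultimately_monotone f \<longleftrightarrow> (\<exists>C0. mono_on {..C0} f \<or> antimono_on {..C0} f)"

section \<open>The bulk density as a distribution\<close>

text \<open>Distributions are represented by their action on test functions.\<close>

definition regular_distr :: "(real \<Rightarrow> real) \<Rightarrow> (real \<Rightarrow> real) \<Rightarrow> real" where
  "regular_distr f \<phi> = (LINT x|lborel. f x * \<phi> x)"

definition distr_deriv :: "((real \<Rightarrow> real) \<Rightarrow> real) \<Rightarrow> (real \<Rightarrow> real) \<Rightarrow> real" where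
  "distr_deriv u \<phi> = - u (deriv \<phi>)"

definition rho_bulk :: "real \<Rightarrow> (nat \<Rightarrow> real) \<Rightarrow> (real \<Rightarrow> real) \<Rightarrow> real" where
  "rho_bulk \<epsilon> lam \<phi> = - distr_deriv (regular_distr (N_mu \<epsilon> lam)) \<phi>"

text \<open>Since \<open>-dN/dC\<close> is a sum of point masses, \<open>u \<sim> v\<close> as \<open>C \<rightarrow> -\<infinity>\<close> is understood after pairing
  with a fixed test profile \<open>\<phi>\<close> transported to the scale \<open>\<pi> - C\<close> (asymptotics of distributions in
  the quasi-asymptotic sense). Nonnegative profiles suffice, because every test function is
  a difference of two such, and for positive \<open>v\<close> they keep the right-hand side away from zero.\<close>

definition rescale :: "real \<Rightarrow> (real \<Rightarrow> real) \<Rightarrow> real \<Rightarrow> real" where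
  "rescale C \<phi> x = \<phi> ((pi - x) / (pi - C))"

definition distr_asymp_equiv ::
  "((real \<Rightarrow> real) \<Rightarrow> real) \<Rightarrow> ((real \<Rightarrow> real) \<Rightarrow> real) \<Rightarrow> bool" where
  "distr_asymp_equiv u v \<longleftrightarrow>
     (\<forall>\<phi>. test_function {0<..} \<phi> \<and> (\<forall>x. \<phi> x \<ge> 0) \<and> (\<exists>x. \<phi> x \<noteq> 0) \<longrightarrow>
        (\<lambda>C. u (rescale C \<phi>)) \<sim>[at_bot] (\<lambda>C. v (rescale C \<phi>)))"

end

theory Submission
  imports Defs "HOL-Real_Asymp.Real_Asymp"
begin

text \<open>
  The encoding turns the condition \<open>C \<le> C\<^sub>n\<close> into \<open>\<lambda>\<^sub>n \<le> (\<pi> - C) / \<epsilon>\<close>, so the counting function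
  of the encoded spectrum is the Laplace counting function evaluated at \<open>(\<pi> - C) / \<epsilon>\<close>
  (\<open>N_mu_eq_N_Delta\<close>). The first asymptotic relation is therefore Weyl's law after an affine change
  of variable, and the converse is the fact that two power laws are asymptotically equivalent only if
  they coincide (\<open>powr_asymp_equiv_unique\<close>). The geometry enters through Weyl's law itself,
  the positivity of the dimension, and the divergence of the eigenvalues, which keeps every count
  finite.

  The distribution \<open>-dN/dC\<close> is the sum of the point masses at the encoded eigenvalues
  (\<open>rho_bulk_eq_sum\<close>), which gives its positivity. An asymptotic relation cannot in general be
  differentiated, but in the distributional sense the derivative falls on the test function, and no
  regularity of \<open>N\<close> is lost. Write \<open>T = \<pi> - C\<close> and \<open>\<beta> = d / 2\<close>. The substitution
  \<open>x = \<pi> - T s\<close> rewrites the pairing of the density with the rescaled test function as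
  \<open>- \<integral> N_Delta (T s / \<epsilon>) \<phi>'(s) ds\<close> (\<open>rho_bulk_rescale\<close>). The support of \<open>\<phi>\<close> stays away from 0,
  so Weyl's law bounds the integrand there uniformly in \<open>s\<close>, and after division by \<open>(T / \<epsilon>)\<^sup>\<beta>\<close>
  dominated convergence gives the limit \<open>- \<gamma> \<integral> s\<^sup>\<beta> \<phi>'(s) ds\<close> (\<open>rescaled_pairing_tendsto\<close>).
  Integration by parts turns this into
  \<open>\<gamma> \<beta> \<integral> s\<^bsup>\<beta> - 1\<^esup> \<phi>(s) ds\<close> (\<open>integral_powr_deriv_by_parts\<close>), which is the pairing with the predicted
  density, because the latter is exactly homogeneous (\<open>regular_distr_powr_rescale\<close>). The integral
  is positive for a nonzero \<open>\<phi> \<ge> 0\<close> (\<open>integral_powr_test_function_pos\<close>), so the two pairings may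
  be divided.
\<close>

section \<open>Test functions of one variable\<close>

lemma test_function_has_derivative:
  assumes "test_function S \<phi>"
  shows "(\<phi> has_real_derivative deriv \<phi> x) (at x)"
    and "continuous_on UNIV (deriv \<phi>)"
proof -
  have "Ck_on (Suc 0) UNIV \<phi>"
    using assms unfolding test_function_def smooth_on_def by blast
  then have diff: "\<And>x. \<phi> differentiable (at x)"
    and cont: "continuous_on UNIV (\<lambda>x. frechet_derivative \<phi> (at x) 1)"
    by auto
  have der: "(\<phi> has_real_derivative deriv \<phi> x) (at x)" for x
    using diff[of x] by (simp add: DERIV_deriv_iff_real_differentiable)
  show "(\<phi> has_real_derivative deriv \<phi> x) (at x)" by (rule der)
  have "frechet_derivative \<phi> (at x) 1 = deriv \<phi> x" for x
    using frechet_derivative_at[OF der[of x, unfolded has_field_derivative_def]]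
    by (metis mult.right_neutral)
  then show "continuous_on UNIV (deriv \<phi>)" using cont by simp
qed

text \<open>Extending the support to an interval makes the boundary terms in the later integrations vanish.
  For a test function on the positive half-line the interval can stay away from 0, where powers
  may be singular: the support is compact, so it has a least element.\<close>

lemma test_function_bounded_support:
  assumes "test_function S \<phi>"
  obtains a b where "a < b" "S \<subseteq> {0<..} \<Longrightarrow> 0 < a"
    "\<And>x. x \<le> a \<or> b \<le> x \<Longrightarrow> \<phi> x = 0 \<and> deriv \<phi> x = 0"
proof -
  define K where "K = closure {x. \<phi> x \<noteq> 0}"
  have "compact K" "K \<subseteq> S" using assms unfolding test_function_def K_def by auto
  have zero: "\<phi> x = 0 \<and> deriv \<phi> x = 0" if "x \<notin> K" for x
  proof -
    have off: "\<And>y. y \<in> - K \<Longrightarrow> \<phi> y = 0"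
      using closure_subset[of "{x. \<phi> x \<noteq> 0}"] unfolding K_def by blast
    have "(\<phi> has_real_derivative 0) (at x)"
      by (rule has_field_derivative_transform_within_open[of "\<lambda>_. 0" 0 x "- K"])
        (use that off compact_imp_closed[OF \<open>compact K\<close>] in auto)
    then show ?thesis using off that by (auto intro: DERIV_imp_deriv)
  qed
  show thesis
  proof (cases "K = {}")
    case True
    then show ?thesis by (intro that[of 1 2] zero) auto
  next
    case False
    obtain m where m: "m \<in> K" "\<And>x. x \<in> K \<Longrightarrow> m \<le> x"
      using compact_attains_inf[OF \<open>compact K\<close> False] by auto
    obtain M where M: "M \<in> K" "\<And>x. x \<in> K \<Longrightarrow> x \<le> M"
      using compact_attains_sup[OF \<open>compact K\<close> False] by auto
    \<comment> \<open>Strictly below \<open>m\<close>, and positive whenever \<open>m\<close> is.\<close>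
    define a where "a = (if m > 0 then m / 2 else m - 1)"
    have "a < m" unfolding a_def by auto
    show ?thesis
    proof (rule that[of a "M + 1"])
      show "a < M + 1" using \<open>a < m\<close> m(2)[OF M(1)] by linarith
      show "0 < a" if "S \<subseteq> {0<..}"
        using that \<open>K \<subseteq> S\<close> m(1) unfolding a_def by auto
      show "\<phi> x = 0 \<and> deriv \<phi> x = 0" if "x \<le> a \<or> M + 1 \<le> x" for x
      proof (rule zero, rule notI)
        assume "x \<in> K"
        with m(2)[of x] M(2)[of x] that \<open>a < m\<close> show False by linarith
      qed
    qed
  qed
qed

lemma integral_restrict_support:
  fixes f :: "real \<Rightarrow> real"
  assumes "\<And>x. x \<notin> {a..b} \<Longrightarrow> f x = 0"
  shows "(LINT x|lborel. f x) = (LINT x|lborel. indicator {a..b} x *\<^sub>R f x)"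
  using assms by (intro Bochner_Integration.integral_cong) (auto simp: indicator_def)

lemma integrable_vanishing_outside:
  fixes f :: "real \<Rightarrow> real"
  assumes "continuous_on {a..b} f" "\<And>x. x \<notin> {a..b} \<Longrightarrow> f x = 0"
  shows "integrable lborel f"
proof -
  have "integrable lborel (\<lambda>x. indicator {a..b} x *\<^sub>R f x)"
    by (intro borel_integrable_compact assms) auto
  also have "(\<lambda>x. indicator {a..b} x *\<^sub>R f x) = f"
    using assms(2) by (auto simp: indicator_def fun_eq_iff)
  finally show ?thesis .
qed

section \<open>Eigenvalue counting\<close>

lemma finite_sublevel:
  fixes lam :: "nat \<Rightarrow> real"
  assumes "filterlim lam at_top sequentially"
  shows "finite {n. lam n \<le> L}"
proof -
  have "eventually (\<lambda>n. L < lam n) sequentially"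
    using assms by (simp add: filterlim_at_top_dense)
  then obtain N where "\<And>n. N \<le> n \<Longrightarrow> L < lam n"
    by (auto simp: eventually_sequentially)
  then have "{n. lam n \<le> L} \<subseteq> {..<N}" by (force simp: not_less[symmetric])
  then show ?thesis by (rule finite_subset) simp
qed

lemma mono_N_Delta:
  assumes "filterlim lam at_top sequentially"
  shows "mono (N_Delta lam)"
  unfolding N_Delta_def
  by (intro monoI of_nat_mono card_mono finite_sublevel[OF assms]) auto

lemma encode_ge_iff:
  assumes "\<epsilon> > 0"
  shows "C \<le> encode \<epsilon> l \<longleftrightarrow> l \<le> (pi - C) / \<epsilon>"
  using assms by (auto simp: encode_def field_simps)

lemma N_mu_eq_N_Delta:
  assumes "\<epsilon> > 0"
  shows "N_mu \<epsilon> lam C = N_Delta lam ((pi - C) / \<epsilon>)"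
  by (simp add: N_mu_def N_Delta_def encode_ge_iff[OF assms])

text \<open>On the support of \<open>\<phi>\<close> the counting function is a finite sum of indicators of half-lines
  \<open>{..c}\<close>, and the integral of \<open>\<phi>'\<close> over such a half-line is \<open>\<phi> c\<close>. The lower bound \<open>a\<close> of the
  support is what makes the sum finite; the value of the sum does not depend on it.\<close>

lemma rho_bulk_eq_sum:
  assumes lam: "filterlim lam at_top sequentially" and eps: "\<epsilon> > 0"
    and phi: "test_function S \<phi>"
    and zero: "\<And>x. x \<le> a \<Longrightarrow> \<phi> x = 0 \<and> deriv \<phi> x = 0"
  shows "rho_bulk \<epsilon> lam \<phi> = (\<Sum>n | a \<le> encode \<epsilon> (lam n). \<phi> (encode \<epsilon> (lam n)))"
proof -
  define c where "c n = encode \<epsilon> (lam n)" for n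
  define F where "F = {n. a \<le> c n}"
  have fin: "finite F"
    unfolding F_def c_def encode_ge_iff[OF eps] by (rule finite_sublevel[OF lam])
  note der = test_function_has_derivative[OF phi]
  have cont: "continuous_on {u..v} (deriv \<phi>)" for u v
    using der(2) by (rule continuous_on_subset) simp
  have "N_mu \<epsilon> lam x * deriv \<phi> x = (\<Sum>n\<in>F. indicator {a..c n} x *\<^sub>R deriv \<phi> x)" for x
  proof (cases "x \<le> a")
    case True
    then show ?thesis using zero by simp
  next
    case False
    then have sub: "{n. x \<le> c n} \<subseteq> F" by (auto simp: F_def)
    have "N_mu \<epsilon> lam x = (\<Sum>n\<in>{n. x \<le> c n}. 1)" by (simp add: N_mu_def c_def)
    also have "\<dots> = (\<Sum>n\<in>F. indicator {a..c n} x)"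
      using False fin sub by (intro sum.mono_neutral_cong_left) (auto simp: indicator_def)
    finally show ?thesis by (simp add: sum_distrib_right)
  qed
  then have "rho_bulk \<epsilon> lam \<phi>
      = (LINT x|lborel. (\<Sum>n\<in>F. indicator {a..c n} x *\<^sub>R deriv \<phi> x))"
    unfolding rho_bulk_def distr_deriv_def regular_distr_def by simp
  also have "\<dots> = (\<Sum>n\<in>F. LINT x|lborel. indicator {a..c n} x *\<^sub>R deriv \<phi> x)"
    by (intro Bochner_Integration.integral_sum borel_integrable_compact cont) auto
  also have "\<dots> = (\<Sum>n\<in>F. \<phi> (c n))"
  proof (rule sum.cong)
    fix n assume "n \<in> F"
    then have "a \<le> c n" by (simp add: F_def)
    then have "(LINT x|lborel. indicator {a..c n} x *\<^sub>R deriv \<phi> x) = \<phi> (c n) - \<phi> a"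
      using der(1)
      by (intro integral_FTC_atLeastAtMost cont)
        (auto simp: has_real_derivative_iff_has_vector_derivative[symmetric]
          intro: has_field_derivative_at_within)
    then show "(LINT x|lborel. indicator {a..c n} x *\<^sub>R deriv \<phi> x) = \<phi> (c n)"
      using zero[of a] by simp
  qed simp
  finally show ?thesis by (simp add: F_def c_def)
qed

section \<open>Pairings with rescaled test functions\<close>

lemma deriv_rescale:
  assumes "test_function S \<phi>"
  shows "deriv (rescale C \<phi>) x = - deriv \<phi> ((pi - x) / (pi - C)) / (pi - C)"
proof -
  have "((\<lambda>x. \<phi> ((pi - x) / (pi - C)))
      has_real_derivative deriv \<phi> ((pi - x) / (pi - C)) * (- 1 / (pi - C))) (at x)"
    by (rule DERIV_chain2[OF test_function_has_derivative(1)[OF assms]], rule DERIV_cdivide)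
      (auto intro!: derivative_eq_intros)
  then show ?thesis unfolding rescale_def[abs_def] by (auto dest: DERIV_imp_deriv)
qed

text \<open>The two minus signs in the definition of the density cancel. The remaining one is the sign of the
  derivative of \<open>(\<pi> - x) / (\<pi> - C)\<close> in \<open>x\<close>, whose modulus cancels against the Jacobian of the
  substitution \<open>x = \<pi> - (\<pi> - C) s\<close>.\<close>

lemma rho_bulk_rescale:
  assumes eps: "\<epsilon> > 0" and phi: "test_function S \<phi>" and C: "C < pi"
  shows "rho_bulk \<epsilon> lam (rescale C \<phi>)
    = - (LINT s|lborel. N_Delta lam ((pi - C) / \<epsilon> * s) * deriv \<phi> s)"
proof -
  define T where "T = pi - C"
  have T: "T > 0" using C by (simp add: T_def)
  have "rho_bulk \<epsilon> lam (rescale C \<phi>)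
      = (LINT x|lborel. N_Delta lam ((pi - x) / \<epsilon>) * (- deriv \<phi> ((pi - x) / T) / T))"
    unfolding rho_bulk_def distr_deriv_def regular_distr_def
    by (simp add: deriv_rescale[OF phi] N_mu_eq_N_Delta[OF eps] T_def)
  also have "\<dots> = T * (LINT s|lborel. - (1 / T) * (N_Delta lam (T / \<epsilon> * s) * deriv \<phi> s))"
    using T by (subst lborel_integral_real_affine[of "- T" _ pi]) (simp_all add: field_simps)
  also have "\<dots> = - (LINT s|lborel. N_Delta lam (T / \<epsilon> * s) * deriv \<phi> s)"
    unfolding integral_mult_right_zero using T by simp
  finally show ?thesis by (simp add: T_def)
qed

text \<open>A power is homogeneous under scaling, and the substitution contributes one further factor
  \<open>\<pi> - C\<close>, which raises the exponent from \<open>\<beta> - 1\<close> to \<open>\<beta>\<close>. The support condition confines the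
  integral to positive arguments, where \<open>powr\<close> is multiplicative.\<close>

lemma regular_distr_powr_rescale:
  assumes phi: "\<And>s. s \<le> 0 \<Longrightarrow> \<phi> s = 0" and C: "C < pi"
  shows "regular_distr (\<lambda>x. k * (pi - x) powr (\<beta> - 1)) (rescale C \<phi>)
    = k * (pi - C) powr \<beta> * (LINT s|lborel. s powr (\<beta> - 1) * \<phi> s)"
proof -
  define T where "T = pi - C"
  have T: "T > 0" using C by (simp add: T_def)
  have pow: "T powr \<beta> = T * T powr (\<beta> - 1)"
    using T by (simp add: powr_diff)
  have "(T * s) powr (\<beta> - 1) * \<phi> s = T powr (\<beta> - 1) * (s powr (\<beta> - 1) * \<phi> s)" for s
    using T phi[of s] by (cases "s \<le> 0") (auto simp: powr_mult)
  then have "(LINT s|lborel. k * (T * s) powr (\<beta> - 1) * \<phi> s)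
      = (LINT s|lborel. (k * T powr (\<beta> - 1)) * (s powr (\<beta> - 1) * \<phi> s))"
    by (intro Bochner_Integration.integral_cong) (simp_all add: mult.assoc)
  also have "\<dots> = k * T powr (\<beta> - 1) * (LINT s|lborel. s powr (\<beta> - 1) * \<phi> s)"
    by (rule integral_mult_right_zero)
  finally have sub: "(LINT s|lborel. k * (T * s) powr (\<beta> - 1) * \<phi> s) = \<dots>" .
  have "regular_distr (\<lambda>x. k * (pi - x) powr (\<beta> - 1)) (rescale C \<phi>)
      = (LINT x|lborel. k * (pi - x) powr (\<beta> - 1) * \<phi> ((pi - x) / T))"
    by (simp add: regular_distr_def rescale_def T_def)
  also have "\<dots> = T * (LINT s|lborel. k * (T * s) powr (\<beta> - 1) * \<phi> s)"
    using T by (subst lborel_integral_real_affine[of "- T" _ pi]) simp_all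
  finally show ?thesis using T by (simp add: sub pow T_def[symmetric])
qed

text \<open>The fundamental theorem of calculus for \<open>s\<^sup>\<beta> \<phi>(s)\<close> on an interval at whose endpoints \<open>\<phi>\<close>
  vanishes. Restricting to a positive interval avoids the point 0, where the power need not be
  differentiable.\<close>

lemma integral_powr_deriv_by_parts:
  assumes phi: "test_function {0<..} \<phi>"
  shows "\<beta> * (LINT s|lborel. s powr (\<beta> - 1) * \<phi> s) = - (LINT s|lborel. s powr \<beta> * deriv \<phi> s)"
proof -
  obtain a b where ab: "a < b" "0 < a"
    and zero: "\<And>x. x \<le> a \<or> b \<le> x \<Longrightarrow> \<phi> x = 0 \<and> deriv \<phi> x = 0"
    by (rule test_function_bounded_support[OF phi]) auto
  note der = test_function_has_derivative[OF phi]
  have contd: "continuous_on {a..b} (deriv \<phi>)"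
    using der(2) by (rule continuous_on_subset) simp
  have cont: "continuous_on {a..b} \<phi>"
    using der(1) by (meson DERIV_isCont continuous_at_imp_continuous_on)
  have cont1: "continuous_on {a..b} (\<lambda>s. s powr (\<beta> - 1) * \<phi> s)"
    and cont2: "continuous_on {a..b} (\<lambda>s. s powr \<beta> * deriv \<phi> s)"
    using ab by (auto intro!: continuous_intros cont contd)
  have "integrable lborel (\<lambda>s. s powr (\<beta> - 1) * \<phi> s)"
    by (rule integrable_vanishing_outside[OF cont1]) (use zero in auto)
  moreover have "integrable lborel (\<lambda>s. s powr \<beta> * deriv \<phi> s)"
    by (rule integrable_vanishing_outside[OF cont2]) (use zero in auto)
  ultimately have "\<beta> * (LINT s|lborel. s powr (\<beta> - 1) * \<phi> s) + (LINT s|lborel. s powr \<beta> * deriv \<phi> s)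
      = (LINT s|lborel. \<beta> * (s powr (\<beta> - 1) * \<phi> s) + s powr \<beta> * deriv \<phi> s)"
    by simp
  also have "\<dots> = (LINT s|lborel.
      indicator {a..b} s *\<^sub>R (\<beta> * (s powr (\<beta> - 1) * \<phi> s) + s powr \<beta> * deriv \<phi> s))"
    by (rule integral_restrict_support) (use zero in auto)
  also have "\<dots> = b powr \<beta> * \<phi> b - a powr \<beta> * \<phi> a"
  proof (rule integral_FTC_atLeastAtMost)
    fix s assume s: "a \<le> s" "s \<le> b"
    have "((\<lambda>s. s powr \<beta> * \<phi> s) has_real_derivative
        \<beta> * (s powr (\<beta> - 1) * \<phi> s) + s powr \<beta> * deriv \<phi> s) (at s)"
      using s ab by (auto intro!: derivative_eq_intros der(1) simp: powr_diff)
    then show "((\<lambda>s. s powr \<beta> * \<phi> s) has_vector_derivative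
        \<beta> * (s powr (\<beta> - 1) * \<phi> s) + s powr \<beta> * deriv \<phi> s) (at s within {a..b})"
      by (simp add: has_real_derivative_iff_has_vector_derivative[symmetric]
          has_field_derivative_at_within)
  qed (use ab in \<open>auto intro!: continuous_intros cont1 cont2\<close>)
  also have "\<dots> = 0" using zero[of a] zero[of b] by simp
  finally show ?thesis by simp
qed

lemma integral_powr_test_function_pos:
  assumes phi: "test_function {0<..} \<phi>" and nonneg: "\<And>x. \<phi> x \<ge> 0" and "\<phi> x0 \<noteq> 0"
  shows "(LINT s|lborel. s powr p * \<phi> s) > 0"
proof -
  obtain a b where ab: "a < b" "0 < a"
    and zero: "\<And>x. x \<le> a \<or> b \<le> x \<Longrightarrow> \<phi> x = 0 \<and> deriv \<phi> x = 0"
    by (rule test_function_bounded_support[OF phi]) auto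
  have "continuous_on {a..b} \<phi>"
    using test_function_has_derivative(1)[OF phi]
    by (meson DERIV_isCont continuous_at_imp_continuous_on)
  then have cont: "continuous_on {a..b} (\<lambda>s. s powr p * \<phi> s)"
    using ab by (auto intro!: continuous_intros)
  have "(LINT s|lborel. s powr p * \<phi> s) = integral {a..b} (\<lambda>s. s powr p * \<phi> s)"
  proof -
    have "set_integrable lborel {a..b} (\<lambda>s. s powr p * \<phi> s)"
      by (rule borel_integrable_atLeastAtMost'[OF cont])
    moreover have "(LINT s|lborel. s powr p * \<phi> s)
        = (LINT s:{a..b}|lborel. s powr p * \<phi> s)"
      unfolding set_lebesgue_integral_def
      by (rule integral_restrict_support) (use zero in auto)
    ultimately show ?thesis by (simp add: set_borel_integral_eq_integral)
  qed
  moreover have "integral {a..b} (\<lambda>s. s powr p * \<phi> s) \<noteq> 0"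
  proof
    assume "integral {a..b} (\<lambda>s. s powr p * \<phi> s) = 0"
    then have "\<forall>s\<in>{a..b}. s powr p * \<phi> s = 0"
      using integral_eq_0_iff[OF cont \<open>a < b\<close>] nonneg by simp
    moreover have x0: "a < x0" "x0 < b"
      using zero[of x0] \<open>\<phi> x0 \<noteq> 0\<close> by argo+
    ultimately have "x0 powr p * \<phi> x0 = 0" by simp
    then show False using x0 ab \<open>\<phi> x0 \<noteq> 0\<close> by simp
  qed
  moreover have "(LINT s|lborel. s powr p * \<phi> s) \<ge> 0"
    using nonneg by (intro Bochner_Integration.integral_nonneg) auto
  ultimately show ?thesis by linarith
qed

section \<open>Power asymptotics\<close>

text \<open>Dominated convergence. For fixed \<open>s > 0\<close>, the ratio \<open>N (T s) / T\<^sup>\<beta>\<close> tends to \<open>c s\<^sup>\<beta>\<close>. Because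
  \<open>\<psi>\<close> lives on \<open>[a, b]\<close> with \<open>a > 0\<close>, all arguments \<open>T s\<close> exceed any given threshold once \<open>T\<close>
  is large, so the same asymptotic relation also yields a majorant that is independent of \<open>T\<close>.
  Monotonicity of \<open>N\<close> makes the integrands measurable.\<close>

lemma rescaled_pairing_tendsto:
  fixes N \<psi> :: "real \<Rightarrow> real"
  assumes mono: "mono N" and N: "N \<sim>[at_top] (\<lambda>t. c * t powr \<beta>)" and c: "c > 0"
    and a: "0 < a" and cont: "continuous_on UNIV \<psi>"
    and zero: "\<And>s. s \<notin> {a..b} \<Longrightarrow> \<psi> s = 0"
  shows "((\<lambda>T. (LINT s|lborel. N (T * s) * \<psi> s) / T powr \<beta>)
    \<longlongrightarrow> c * (LINT s|lborel. s powr \<beta> * \<psi> s)) at_top"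
proof -
  have [measurable]: "N \<in> borel_measurable borel" by (rule borel_measurable_mono[OF mono])
  have [measurable]: "\<psi> \<in> borel_measurable borel"
    by (rule borel_measurable_continuous_onI[OF cont])
  have contw: "continuous_on {a..b} (\<lambda>s. 2 * c * (s powr \<beta> * \<bar>\<psi> s\<bar>))"
    using a by (intro continuous_intros continuous_on_subset[OF cont]) auto
  have "((\<lambda>T. LINT s|lborel. N (T * s) / T powr \<beta> * \<psi> s)
      \<longlongrightarrow> (LINT s|lborel. c * s powr \<beta> * \<psi> s)) at_top"
  proof (rule integral_dominated_convergence_at_top)
    show "integrable lborel (\<lambda>s. 2 * c * (s powr \<beta> * \<bar>\<psi> s\<bar>))"
      by (rule integrable_vanishing_outside[OF contw]) (use zero in auto)
    \<comment> \<open>Any factor greater than 1 serves in the majorant.\<close>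
    have "eventually (\<lambda>t. norm (N t) \<le> 2 * norm (c * t powr \<beta>)) at_top"
      by (rule asymp_equiv_imp_eventually_le[OF N]) simp
    then obtain t0 where t0: "\<And>t. t0 \<le> t \<Longrightarrow> \<bar>N t\<bar> \<le> 2 * (c * t powr \<beta>)"
      using c by (auto simp: eventually_at_top_linorder abs_mult)
    show "\<forall>\<^sub>F T in at_top. AE s in lborel.
        norm (N (T * s) / T powr \<beta> * \<psi> s) \<le> 2 * c * (s powr \<beta> * \<bar>\<psi> s\<bar>)"
      using eventually_ge_at_top[of "t0 / a"] eventually_gt_at_top[of 0]
    proof eventually_elim
      case (elim T)
      have "norm (N (T * s) / T powr \<beta> * \<psi> s) \<le> 2 * c * (s powr \<beta> * \<bar>\<psi> s\<bar>)" for s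
      proof (cases "s \<in> {a..b}")
        case True
        have "t0 \<le> T * a" using elim a by (simp add: field_simps)
        also have "\<dots> \<le> T * s" using True elim by (intro mult_left_mono) auto
        finally have "\<bar>N (T * s)\<bar> \<le> 2 * (c * (T * s) powr \<beta>)" by (rule t0)
        also have "(T * s) powr \<beta> = T powr \<beta> * s powr \<beta>"
          using True elim a by (simp add: powr_mult)
        finally have "\<bar>N (T * s)\<bar> / T powr \<beta> \<le> 2 * c * s powr \<beta>"
          using elim by (simp add: divide_le_eq mult_ac)
        from mult_right_mono[OF this, of "\<bar>\<psi> s\<bar>"] show ?thesis
          by (simp add: abs_mult mult_ac)
      next
        case False
        then show ?thesis using zero by simp
      qed
      then show ?case by simp
    qed
    have "((\<lambda>T. N (T * s) / T powr \<beta> * \<psi> s) \<longlongrightarrow> c * s powr \<beta> * \<psi> s) at_top" for s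
    proof (cases "s \<in> {a..b}")
      case True
      then have s: "s > 0" using a by simp
      have "eventually (\<lambda>t. N t \<noteq> 0 \<or> c * t powr \<beta> \<noteq> 0) at_top"
        using eventually_gt_at_top[of 0] by eventually_elim (use c in simp)
      then have "((\<lambda>t. N t / (c * t powr \<beta>)) \<longlongrightarrow> 1) at_top"
        by (rule asymp_equivD_strong[OF N])
      moreover have "filterlim (\<lambda>T. T * s) at_top at_top"
        using s by real_asymp
      ultimately have "((\<lambda>T. N (T * s) / (c * (T * s) powr \<beta>)) \<longlongrightarrow> 1) at_top"
        by (rule filterlim_compose)
      then have "((\<lambda>T. N (T * s) / (c * (T * s) powr \<beta>) * (c * s powr \<beta> * \<psi> s))
          \<longlongrightarrow> 1 * (c * s powr \<beta> * \<psi> s)) at_top"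
        by (intro tendsto_intros)
      moreover have "\<forall>\<^sub>F T in at_top. N (T * s) / (c * (T * s) powr \<beta>) * (c * s powr \<beta> * \<psi> s)
          = N (T * s) / T powr \<beta> * \<psi> s"
        using eventually_gt_at_top[of 0]
        by eventually_elim (use s c in \<open>simp add: powr_mult field_simps\<close>)
      ultimately have "((\<lambda>T. N (T * s) / T powr \<beta> * \<psi> s) \<longlongrightarrow> 1 * (c * s powr \<beta> * \<psi> s)) at_top"
        by (rule Lim_transform_eventually)
      then show ?thesis by simp
    qed (use zero in simp)
    then show "AE s in lborel. ((\<lambda>T. N (T * s) / T powr \<beta> * \<psi> s) \<longlongrightarrow> c * s powr \<beta> * \<psi> s) at_top"
      by simp
  qed simp_all
  moreover have "(LINT s|lborel. N (T * s) / T powr \<beta> * \<psi> s)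
      = (LINT s|lborel. N (T * s) * \<psi> s) / T powr \<beta>" for T
    by (subst integral_divide_zero[symmetric]) simp
  moreover have "(LINT s|lborel. c * s powr \<beta> * \<psi> s) = c * (LINT s|lborel. s powr \<beta> * \<psi> s)"
    by (subst integral_mult_right_zero[symmetric]) (simp add: mult.assoc)
  ultimately show ?thesis by simp
qed

text \<open>The quotient \<open>(A / B) t\<^bsup>p - q\<^esup>\<close> has the limit 0, \<open>A / B\<close> or infinity, according to the sign of
  \<open>p - q\<close>; asymptotic equivalence asks for the limit 1.\<close>

lemma powr_asymp_equiv_unique:
  fixes A B p q :: real
  assumes equiv: "(\<lambda>t. A * t powr p) \<sim>[at_top] (\<lambda>t. B * t powr q)" and A: "A > 0" and B: "B > 0"
  shows "p = q \<and> A = B"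
proof -
  have "eventually (\<lambda>t. A * t powr p \<noteq> 0 \<or> B * t powr q \<noteq> 0) at_top"
    using eventually_gt_at_top[of 0] by eventually_elim (use A in simp)
  then have "((\<lambda>t. A * t powr p / (B * t powr q)) \<longlongrightarrow> 1) at_top"
    by (rule asymp_equivD_strong[OF equiv])
  moreover have "\<forall>\<^sub>F t in at_top. A * t powr p / (B * t powr q) = A / B * t powr (p - q)"
    using eventually_gt_at_top[of 0] by eventually_elim (simp add: powr_diff)
  ultimately have lim: "((\<lambda>t. A / B * t powr (p - q)) \<longlongrightarrow> 1) at_top"
    by (rule Lim_transform_eventually)
  have "A / B > 0" using A B by simp
  have "p = q"
  proof (cases p q rule: linorder_cases)
    case less
    then have "((\<lambda>t. A / B * t powr (p - q)) \<longlongrightarrow> 0) at_top"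
      by real_asymp
    then show ?thesis using tendsto_unique[OF _ lim] by fastforce
  next
    case greater
    then have "filterlim (\<lambda>t. A / B * t powr (p - q)) at_top at_top"
      using \<open>A / B > 0\<close>
      by (intro filterlim_tendsto_pos_mult_at_top[OF tendsto_const]) (simp, real_asymp)
    then show ?thesis
      using lim not_tendsto_and_filterlim_at_infinity[of at_top]
        filterlim_at_top_imp_at_infinity by (metis trivial_limit_at_top_linorder)
  qed
  have "\<forall>\<^sub>F t in at_top. A / B * t powr (p - q) = A / B"
    using eventually_gt_at_top[of 0] by eventually_elim (simp add: \<open>p = q\<close>)
  with lim have "((\<lambda>t::real. A / B) \<longlongrightarrow> 1) at_top"
    by (rule Lim_transform_eventually)
  then have "A / B = 1" by (simp add: tendsto_const_iff)
  then show ?thesis using \<open>p = q\<close> B by simp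
qed

section \<open>The bulk density and Weyl's law\<close>

theorem theorem3p1:
  fixes X :: "'a topology"
    and \<A> :: "('a, 'd::finite) chart set"
    and g :: "('a, 'd) chart \<Rightarrow> real ^ 'd \<Rightarrow> real ^ 'd ^ 'd"
    and lam :: "nat \<Rightarrow> real"
    and \<gamma> \<epsilon> :: real
    and d :: nat
  assumes dim: "d = CARD('d)"
    and manifold: "smooth_manifold X \<A>" "compact_space X" "connected_space X"
    and metric: "riemannian_metric \<A> g"
    and spectrum: "laplace_spectrum X \<A> g lam"
    and gamma: "\<gamma> > 0"
    and weyl: "N_Delta lam \<sim>[at_top] (\<lambda>\<Lambda>. \<gamma> * \<Lambda> powr (real d / 2))"
    and eps: "\<epsilon> > 0"
  shows "(N_mu \<epsilon> lam \<sim>[at_bot] (\<lambda>C. \<gamma> * \<epsilon> powr (- real d / 2) * (pi - C) powr (real d / 2)))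
    \<and> (\<forall>\<phi>. test_function {..<pi} \<phi> \<and> (\<forall>x. \<phi> x \<ge> 0) \<longrightarrow> rho_bulk \<epsilon> lam \<phi> \<ge> 0)
    \<and> distr_asymp_equiv (rho_bulk \<epsilon> lam)
        (regular_distr
          (\<lambda>C. real d / 2 * \<gamma> * \<epsilon> powr (- real d / 2) * (pi - C) powr ((real d - 2) / 2)))
    \<and> (\<forall>A \<alpha>. A > 0 \<and> \<alpha> > 0 \<and> N_mu \<epsilon> lam \<sim>[at_bot] (\<lambda>C. A * (pi - C) powr \<alpha>) \<and>
          ultimately_monotone (N_mu \<epsilon> lam) \<longrightarrow>
          real d = 2 * \<alpha> \<and> \<gamma> = A * \<epsilon> powr (real d / 2))"
proof -
  define \<beta> where "\<beta> = real d / 2"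
  have \<beta>: "\<beta> > 0" by (simp add: \<beta>_def dim)
  have exps: "- real d / 2 = - \<beta>" "(real d - 2) / 2 = \<beta> - 1" "real d / 2 = \<beta>"
    by (simp_all add: \<beta>_def field_simps)
  define c where "c = \<gamma> * \<epsilon> powr (- \<beta>)"
  have c: "c > 0" using gamma eps by (simp add: c_def)
  have lam: "filterlim lam at_top sequentially"
    using spectrum by (simp add: laplace_spectrum_def)
  have weyl': "N_Delta lam \<sim>[at_top] (\<lambda>t. \<gamma> * t powr \<beta>)" using weyl by (simp add: \<beta>_def)
  have scale: "filterlim (\<lambda>C. (pi - C) / \<epsilon>) at_top at_bot"
    using eps by real_asymp
  have below: "\<forall>\<^sub>F C in at_bot. C < pi"
    unfolding eventually_at_bot_dense by blast

  have part1: "N_mu \<epsilon> lam \<sim>[at_bot] (\<lambda>C. c * (pi - C) powr \<beta>)"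
  proof -
    have "(\<lambda>C. N_Delta lam ((pi - C) / \<epsilon>)) \<sim>[at_bot] (\<lambda>C. \<gamma> * ((pi - C) / \<epsilon>) powr \<beta>)"
      by (rule asymp_equiv_compose'[OF weyl' scale])
    moreover have "\<forall>\<^sub>F C in at_bot. \<gamma> * ((pi - C) / \<epsilon>) powr \<beta> = c * (pi - C) powr \<beta>"
      using below
      by eventually_elim (use eps in \<open>simp add: c_def powr_divide powr_minus field_simps\<close>)
    ultimately have "(\<lambda>C. N_Delta lam ((pi - C) / \<epsilon>)) \<sim>[at_bot] (\<lambda>C. c * (pi - C) powr \<beta>)"
      by (rule asymp_equiv_transfer[OF _ always_eventually[OF allI[OF refl]]])
    then show ?thesis by (simp add: N_mu_eq_N_Delta[OF eps, abs_def])
  qed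

  have part2: "rho_bulk \<epsilon> lam \<phi> \<ge> 0"
    if phi: "test_function {..<pi} \<phi>" and nonneg: "\<And>x. \<phi> x \<ge> 0" for \<phi>
  proof -
    obtain a b where "\<And>x. x \<le> a \<or> b \<le> x \<Longrightarrow> \<phi> x = 0 \<and> deriv \<phi> x = 0"
      by (rule test_function_bounded_support[OF phi]) blast
    then show ?thesis
      using nonneg by (subst rho_bulk_eq_sum[OF lam eps phi, of a]) (auto intro: sum_nonneg)
  qed

  have part3: "distr_asymp_equiv (rho_bulk \<epsilon> lam)
      (regular_distr (\<lambda>C. \<beta> * c * (pi - C) powr (\<beta> - 1)))"
    unfolding distr_asymp_equiv_def
  proof (intro allI impI, elim conjE exE)
    fix \<phi> :: "real \<Rightarrow> real" and x0
    assume phi: "test_function {0<..} \<phi>" and nonneg: "\<forall>x. \<phi> x \<ge> 0" and x0: "\<phi> x0 \<noteq> 0"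
    obtain a b where a: "0 < a"
      and zero: "\<And>x. x \<le> a \<or> b \<le> x \<Longrightarrow> \<phi> x = 0 \<and> deriv \<phi> x = 0"
      by (rule test_function_bounded_support[OF phi]) auto
    define I where "I = (LINT s|lborel. s powr (\<beta> - 1) * \<phi> s)"
    have I: "I > 0"
      unfolding I_def by (rule integral_powr_test_function_pos[OF phi _ x0]) (use nonneg in auto)
    have "((\<lambda>T. (LINT s|lborel. N_Delta lam (T * s) * deriv \<phi> s) / T powr \<beta>)
        \<longlongrightarrow> \<gamma> * (LINT s|lborel. s powr \<beta> * deriv \<phi> s)) at_top"
      by (rule rescaled_pairing_tendsto[OF mono_N_Delta[OF lam] weyl' gamma a
            test_function_has_derivative(2)[OF phi], of b]) (use zero in auto)
    also have "(LINT s|lborel. s powr \<beta> * deriv \<phi> s) = - (\<beta> * I)"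
      using integral_powr_deriv_by_parts[OF phi, of \<beta>] by (simp add: I_def)
    finally have "((\<lambda>C. (LINT s|lborel. N_Delta lam ((pi - C) / \<epsilon> * s) * deriv \<phi> s)
        / ((pi - C) / \<epsilon>) powr \<beta>) \<longlongrightarrow> \<gamma> * - (\<beta> * I)) at_bot"
      by (rule filterlim_compose[OF _ scale])
    then have "((\<lambda>C. (LINT s|lborel. N_Delta lam ((pi - C) / \<epsilon> * s) * deriv \<phi> s)
        / ((pi - C) / \<epsilon>) powr \<beta> / (\<gamma> * - (\<beta> * I))) \<longlongrightarrow> \<gamma> * - (\<beta> * I) / (\<gamma> * - (\<beta> * I))) at_bot"
      using gamma \<beta> I by (intro tendsto_divide tendsto_const) auto
    moreover have "\<gamma> * - (\<beta> * I) / (\<gamma> * - (\<beta> * I)) = 1" using gamma \<beta> I by simp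
    moreover have "\<forall>\<^sub>F C in at_bot. (LINT s|lborel. N_Delta lam ((pi - C) / \<epsilon> * s) * deriv \<phi> s)
        / ((pi - C) / \<epsilon>) powr \<beta> / (\<gamma> * - (\<beta> * I))
      = rho_bulk \<epsilon> lam (rescale C \<phi>)
        / regular_distr (\<lambda>x. \<beta> * c * (pi - x) powr (\<beta> - 1)) (rescale C \<phi>)"
      using below
    proof eventually_elim
      case (elim C)
      have "((pi - C) / \<epsilon>) powr \<beta> * (\<gamma> * (\<beta> * I)) = \<beta> * c * (pi - C) powr \<beta> * I"
        using elim eps by (simp add: c_def powr_divide powr_minus field_simps)
      also have "\<dots> = regular_distr (\<lambda>x. \<beta> * c * (pi - x) powr (\<beta> - 1)) (rescale C \<phi>)"
        unfolding I_def
        by (rule regular_distr_powr_rescale[symmetric]) (use elim zero a in auto)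
      finally show ?case
        using rho_bulk_rescale[OF eps phi elim, of lam] by simp
    qed
    ultimately show "(\<lambda>C. rho_bulk \<epsilon> lam (rescale C \<phi>)) \<sim>[at_bot]
        (\<lambda>C. regular_distr (\<lambda>x. \<beta> * c * (pi - x) powr (\<beta> - 1)) (rescale C \<phi>))"
      by (intro asymp_equivI') (auto intro: Lim_transform_eventually)
  qed

  have part4: "\<beta> = \<alpha> \<and> \<gamma> = A * \<epsilon> powr \<beta>"
    if A: "A > 0" and equiv: "N_mu \<epsilon> lam \<sim>[at_bot] (\<lambda>C. A * (pi - C) powr \<alpha>)" for A \<alpha>
  proof -
    have "(\<lambda>C. c * (pi - C) powr \<beta>) \<sim>[at_bot] (\<lambda>C. A * (pi - C) powr \<alpha>)"
      using asymp_equiv_trans[OF asymp_equiv_symI[OF part1] equiv] .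
    moreover have "filterlim (\<lambda>t::real. pi - t) at_bot at_top" by real_asymp
    ultimately have "(\<lambda>t. c * (pi - (pi - t)) powr \<beta>) \<sim>[at_top] (\<lambda>t. A * (pi - (pi - t)) powr \<alpha>)"
      by (rule asymp_equiv_compose')
    then have "\<beta> = \<alpha> \<and> c = A"
      using powr_asymp_equiv_unique[of c \<beta> A \<alpha>] c A by simp
    then show ?thesis using eps by (auto simp: c_def powr_minus)
  qed

  have density: "\<beta> * \<gamma> * \<epsilon> powr (- \<beta>) = \<beta> * c" by (simp add: c_def)
  show ?thesis
    unfolding exps density c_def[symmetric]
  proof (intro conjI allI impI)
    show "N_mu \<epsilon> lam \<sim>[at_bot] (\<lambda>C. c * (pi - C) powr \<beta>)" by (rule part1)
    show "distr_asymp_equiv (rho_bulk \<epsilon> lam)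
        (regular_distr (\<lambda>C. \<beta> * c * (pi - C) powr (\<beta> - 1)))" by (rule part3)
  next
    fix \<phi> assume "test_function {..<pi} \<phi> \<and> (\<forall>x. \<phi> x \<ge> 0)"
    then show "rho_bulk \<epsilon> lam \<phi> \<ge> 0" using part2 by blast
  next
    fix A \<alpha> assume "A > 0 \<and> \<alpha> > 0 \<and> N_mu \<epsilon> lam \<sim>[at_bot] (\<lambda>C. A * (pi - C) powr \<alpha>) \<and>
      ultimately_monotone (N_mu \<epsilon> lam)"
    then have "\<beta> = \<alpha> \<and> \<gamma> = A * \<epsilon> powr \<beta>" using part4 by blast
    then show "real d = 2 * \<alpha>" "\<gamma> = A * \<epsilon> powr \<beta>" by (auto simp: \<beta>_def)
  qed
qed

end
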